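(* Let $\mathbb{F}$ be an infinite field (of arbitrary infinite cardinality) and let $V$ be a vector space over $\mathbb{F}$ of countably infinite dimension. Then $V$ is not weakly indivisible. In fact, there is a partition of $V$ into two parts such that neither part contains an affine line.
   Context: An affine line of $V$ is a set $v+W$ with $v\in V$ and $W$ a one-dimensional linear subspace of $V$. An affine embedding of $V$ is an injective map $\epsilon:V\to V$ of the form $\epsilon(v)=w+\rho(v)$ with $w\in V$ fixed and $\rho:V\to V$ linear. The affine cycle structure of $V$: a finite sequence $\langle v_i:i\in n\rangle$ of affinely dependent elements of $V$ is an affine cycle if no proper subsequence is affinely dependent. Two affine cycles $\langle v_i:i\in n\rangle$ and $\langle v_i':i\in n\rangle$ are equivalent if there is an invertible affine transformation $\tau$ from the affine space generated by $\{v_i:i\in n\}$ onto the affine space generated by $\{v'_i:i\in n\}$ with $\tau(v_i)=v_i'$ for all $i\in n$. The affine cycle structure of $V$ is the relational structure with base set $V$ having each equivalence class of affine cycles as a relation. The age of a relational structure is the class of finite relational structures isomorphic to one of its induced substructures on a nonempty finite subset of the base set. For $P\subseteq V$, $\mathrm{age}(V{\restriction}P)$ denotes the age of the substructure of the affine cycle structure of $V$ induced on $P$, and $\mathrm{age}(V)=\mathrm{age}(V{\restriction}V)$. The vector space $V$ is weakly indivisible if for every partition $(P_0,P_1)$ of $V$ with $\mathrm{age}(V{\restriction}P_0)\neq\mathrm{age}(V)$ there exists an affine embedding $\epsilon$ of $V$ with $\epsilon[V]\subseteq P_1$. *)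

theory Defs
  imports "HOL.Vector_Spaces" "HOL-Library.Sublist" "HOL-Library.Disjoint_Sets" "HOL-Library.Countable_Set"
begin

text \<open>
  Relational structures with relation symbols in \<open>'r\<close>; relations of all finite arities are
  sets of lists. A symbol outside the signature is interpreted by the empty relation.
\<close>

record ('x, 'r) rel_struct =
  base :: "'x set"
  rel :: "'r \<Rightarrow> 'x list set"

definition induced :: "('x, 'r) rel_struct \<Rightarrow> 'x set \<Rightarrow> ('x, 'r) rel_struct" where
  "induced A P = \<lparr>base = base A \<inter> P, rel = (\<lambda>R. rel A R \<inter> lists P)\<rparr>"

definition struct_iso :: "('x, 'r) rel_struct \<Rightarrow> ('y, 'r) rel_struct \<Rightarrow> bool" where
  "struct_iso A B \<longleftrightarrow>
     (\<exists>f. bij_betw f (base A) (base B) \<and> (\<forall>R. rel B R = map f ` rel A R))"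

text \<open>
  The age is a proper class closed under isomorphism. Every finite structure is isomorphic to
  one with base set in \<open>nat\<close>, so the class is determined by its members of that kind; these
  are the ones collected here, and two ages are equal as classes iff these sets are equal.
\<close>

definition age :: "('x, 'r) rel_struct \<Rightarrow> (nat, 'r) rel_struct set" where
  "age A = {B. \<exists>S. S \<subseteq> base A \<and> finite S \<and> S \<noteq> {} \<and> struct_iso (induced A S) B}"

definition two_partition :: "'x set \<Rightarrow> 'x set \<Rightarrow> 'x set \<Rightarrow> bool" where
  "two_partition X P Q \<longleftrightarrow> P \<noteq> Q \<and> partition_on X {P, Q}"

context vector_space
begin

definition countably_infinite_dimensional :: bool where
  "countably_infinite_dimensional \<longleftrightarrow>
     (\<exists>B. independent B \<and> span B = UNIV \<and> countable B \<and> infinite B)"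

definition affine_subspace :: "'b set \<Rightarrow> bool" where
  "affine_subspace A \<longleftrightarrow> (\<exists>v W. subspace W \<and> A = (+) v ` W)"

definition affine_line :: "'b set \<Rightarrow> bool" where
  "affine_line L \<longleftrightarrow> (\<exists>v W. subspace W \<and> dim W = 1 \<and> L = (+) v ` W)"

definition affine_map_on :: "'b set \<Rightarrow> ('b \<Rightarrow> 'b) \<Rightarrow> bool" where
  "affine_map_on A f \<longleftrightarrow>
     (\<exists>w \<rho>. Vector_Spaces.linear scale scale \<rho> \<and> (\<forall>x\<in>A. f x = w + \<rho> x))"

definition affine_embedding :: "('b \<Rightarrow> 'b) \<Rightarrow> bool" where
  "affine_embedding \<epsilon> \<longleftrightarrow> inj \<epsilon> \<and> affine_map_on UNIV \<epsilon>"

text \<open>Dependence of sequences, as indexed families: \<open>[v, v]\<close> is dependent.\<close>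

definition affinely_dependent :: "'b list \<Rightarrow> bool" where
  "affinely_dependent vs \<longleftrightarrow>
     (\<exists>c :: nat \<Rightarrow> 'a. (\<exists>i<length vs. c i \<noteq> 0) \<and>
        (\<Sum>i<length vs. c i) = 0 \<and> (\<Sum>i<length vs. scale (c i) (vs ! i)) = 0)"

definition affine_cycle :: "'b list \<Rightarrow> bool" where
  "affine_cycle vs \<longleftrightarrow>
     affinely_dependent vs \<and> (\<forall>us. strict_subseq us vs \<longrightarrow> \<not> affinely_dependent us)"

definition cycle_equiv :: "('b list \<times> 'b list) set" where
  "cycle_equiv = {(us, vs). affine_cycle us \<and> affine_cycle vs \<and>
     (\<exists>\<tau>. affine_map_on (affine_subspace hull set us) \<tau> \<and>
        bij_betw \<tau> (affine_subspace hull set us) (affine_subspace hull set vs) \<and>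
        map \<tau> us = vs)}"

text \<open>The relation symbols are the equivalence classes, each interpreted by itself.\<close>

definition affine_cycle_structure :: "('b, 'b list set) rel_struct" where
  "affine_cycle_structure =
     \<lparr>base = UNIV,
      rel = (\<lambda>R. if R \<in> Collect affine_cycle // cycle_equiv then R else {})\<rparr>"

definition weakly_indivisible :: bool where
  "weakly_indivisible \<longleftrightarrow>
     (\<forall>P0 P1. two_partition (UNIV :: 'b set) P0 P1 \<and>
        age (induced affine_cycle_structure P0) \<noteq> age affine_cycle_structure \<longrightarrow>
        (\<exists>\<epsilon>. affine_embedding \<epsilon> \<and> range \<epsilon> \<subseteq> P1))"

end

end

theory Submission imports Defs begin

text \<open>
  A single set \<open>P\<close> gives both claims: it meets every affine line but contains no three collinear
  points. Lines are infinite, so no line lies in \<open>P\<close>, and none lies in \<open>- P\<close>; hence \<open>{P, - P}\<close>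
  is the required partition. It also refutes weak indivisibility. The image of an affine embedding
  contains a line, so it is not contained in \<open>- P\<close>. On the other hand, if \<open>b \<noteq> 0\<close> and \<open>c\<close> is a
  scalar other than 0 and 1, then \<open>[0, b, c b]\<close> is an affine cycle, and all cycles equivalent to
  it are again collinear triples, because an affine map sends it to \<open>[w, w + \<rho> b, w + c \<rho> b]\<close>
  with \<open>\<rho>\<close> linear. So the three-element structure with this cycle belongs to the age of the space
  but not to the age of \<open>P\<close>.

  To find \<open>P\<close>, let \<open>\<kappa>\<close> be the cardinality of the field. A vector space of countable dimension is a
  countable union of spans of finite sets, so it has at most \<open>\<kappa>\<close> vectors and at most \<open>\<kappa>\<close> lines,
  while each line has \<open>\<kappa>\<close> points. Well-order the lines in such a way that each has fewer than \<open>\<kappa>\<close>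
  predecessors, and choose a point on each line by transfinite recursion. If the line already
  contains a chosen point, choose that point again. Otherwise the fewer than \<open>\<kappa>\<close> pairs of
  previously chosen points span fewer than \<open>\<kappa>\<close> lines, each of which meets the present line in at
  most one point; so some point on it is collinear with no such pair, and it is chosen. This step
  uses only that distinct lines share at most one point, and is carried out in
  \<open>exists_blocking_set_without_collinear_triples\<close> for abstract systems of lines.
\<close>

unbundle cardinal_syntax

section \<open>Blocking sets without collinear triples\<close>

lemma card_of_Times_same_less_infinite:
  assumes "infinite C" and "|A| <o |C|"
  shows "|A \<times> A| <o |C|"
proof (cases "finite A")
  case True
  then show ?thesis
    using assms(1) by (intro finite_ordLess_infinite) (simp_all add: card_of_well_order_on Field_card_of)
next
  case False
  then show ?thesis
    using card_of_Times_same_infinite[of A] assms(2) ordIso_ordLess_trans by blast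
qed

definition collinear_in :: "'p set set \<Rightarrow> 'p \<Rightarrow> 'p \<Rightarrow> 'p \<Rightarrow> bool" where
  "collinear_in \<L> x y z \<longleftrightarrow> (\<exists>M\<in>\<L>. {x, y, z} \<subseteq> M)"

definition partial_linear_space :: "'p set set \<Rightarrow> bool" where
  "partial_linear_space \<L> \<longleftrightarrow>
     (\<forall>L\<in>\<L>. \<forall>M\<in>\<L>. \<forall>x y. {x, y} \<subseteq> L \<inter> M \<and> x \<noteq> y \<longrightarrow> L = M)"

lemma partial_linear_spaceD:
  "\<lbrakk>partial_linear_space \<L>; L \<in> \<L>; M \<in> \<L>; {x, y} \<subseteq> L \<inter> M; x \<noteq> y\<rbrakk> \<Longrightarrow> L = M"
  unfolding partial_linear_space_def by blast

text \<open>
  One step of the recursion: a line through two points of \<open>A\<close> is different from \<open>L\<close>, so the pair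
  excludes at most one point of \<open>L\<close>, and there are fewer pairs than points of \<open>L\<close>.
\<close>

lemma exists_noncollinear_point:
  assumes pls: "partial_linear_space \<L>"
    and L: "L \<in> \<L>" "infinite L" and A: "|A| <o |L|" "L \<inter> A = {}"
  obtains x where "x \<in> L"
    "\<And>y z. \<lbrakk>y \<in> A; z \<in> A; y \<noteq> z\<rbrakk> \<Longrightarrow> \<not> collinear_in \<L> x y z"
proof -
  let ?bad = "\<lambda>x y z. x \<in> L \<and> y \<noteq> z \<and> collinear_in \<L> x y z"
  \<comment> \<open>The point of \<open>L\<close> that the pair excludes; an arbitrary value if it excludes none.\<close>
  define h where "h = (\<lambda>(y, z). SOME x. ?bad x y z)"
  have unique: "x = x'" if bad: "?bad x y z" "?bad x' y z" and "y \<in> A" for x x' y z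
  proof (rule ccontr)
    assume "x \<noteq> x'"
    obtain M where M: "M \<in> \<L>" "{x, y, z} \<subseteq> M"
      using bad(1) unfolding collinear_in_def by blast
    obtain M' where M': "M' \<in> \<L>" "{x', y, z} \<subseteq> M'"
      using bad(2) unfolding collinear_in_def by blast
    have "M = M'"
      using partial_linear_spaceD[OF pls M(1) M'(1), of y z] M(2) M'(2) bad(1) by blast
    then have "M = L"
      using partial_linear_spaceD[OF pls M(1) L(1), of x x'] M(2) M'(2) bad \<open>x \<noteq> x'\<close> by blast
    then show False
      using A(2) M(2) \<open>y \<in> A\<close> by blast
  qed
  have "\<not> L \<subseteq> h ` (A \<times> A)"
  proof
    assume "L \<subseteq> h ` (A \<times> A)"
    then have "|L| \<le>o |A \<times> A|"
      by (meson card_of_image card_of_mono1 ordLeq_transitive)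
    then show False
      using card_of_Times_same_less_infinite[OF L(2) A(1)] not_ordLess_ordLeq by blast
  qed
  then obtain x where x: "x \<in> L" "x \<notin> h ` (A \<times> A)"
    by blast
  show thesis
  proof (rule that[OF x(1)])
    fix y z
    assume yz: "y \<in> A" "z \<in> A" "y \<noteq> z"
    show "\<not> collinear_in \<L> x y z"
    proof
      assume "collinear_in \<L> x y z"
      then have bad: "?bad x y z"
        using x(1) yz by blast
      then have "?bad (h (y, z)) y z"
        unfolding h_def using someI[of "\<lambda>x. ?bad x y z" x] by simp
      then have "h (y, z) = x"
        using unique bad yz(1) by blast
      then show False
        using x(2) yz by force
    qed
  qed
qed

text \<open>
  In the cardinal order of the set of lines every line has fewer predecessors than it has
  points, so the previous lemma applies at each stage.
\<close>

lemma exists_blocking_set_without_collinear_triples: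
  assumes pls: "partial_linear_space \<L>"
    and inf: "\<And>L. L \<in> \<L> \<Longrightarrow> infinite L"
    and card: "\<And>L. L \<in> \<L> \<Longrightarrow> |\<L>| \<le>o |L|"
  obtains P where "\<And>L. L \<in> \<L> \<Longrightarrow> L \<inter> P \<noteq> {}"
    "\<And>x y z. \<lbrakk>{x, y, z} \<subseteq> P; distinct [x, y, z]\<rbrakk> \<Longrightarrow> \<not> collinear_in \<L> x y z"
proof -
  define r where "r = |\<L>|"
  interpret wo_rel r
    unfolding r_def wo_rel_def by (rule card_of_Well_order)
  have Field: "Field r = \<L>"
    unfolding r_def by (rule Field_card_of)
  \<comment> \<open>The point \<open>x\<close> may be chosen on \<open>L\<close>, given the choices \<open>f\<close> on the preceding lines. Repeating
    an earlier choice makes \<open>f\<close> total, so that the chosen points form just the image of \<open>\<L>\<close>.\<close>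
  define good where "good = (\<lambda>f L x. x \<in> L \<and> (x \<in> f ` underS L \<or>
    (\<forall>y\<in>f ` underS L. \<forall>z\<in>f ` underS L. y \<noteq> z \<longrightarrow> \<not> collinear_in \<L> x y z)))"
  have "\<exists>f. \<forall>L. L \<in> \<L> \<longrightarrow> good f L (f L)"
  proof (rule dependent_wf_choice[OF WF])
    fix f g :: "'a set \<Rightarrow> 'a" and L x
    assume "\<And>M. (M, L) \<in> r - Id \<Longrightarrow> f M = g M"
    then have "f ` underS L = g ` underS L"
      unfolding underS_def by (intro image_cong) auto
    then show "(L \<in> \<L> \<longrightarrow> good f L x) = (L \<in> \<L> \<longrightarrow> good g L x)"
      unfolding good_def by simp
  next
    fix L and f :: "'a set \<Rightarrow> 'a"
    show "\<exists>x. L \<in> \<L> \<longrightarrow> good f L x"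
    proof (cases "L \<in> \<L> \<and> L \<inter> f ` underS L = {}")
      case True
      then have L: "L \<in> \<L>" "L \<inter> f ` underS L = {}"
        by auto
      have "|underS L| <o |\<L>|"
        unfolding r_def by (rule card_of_underS) (simp_all add: card_of_card_order_on Field_card_of L)
      then have "|f ` underS L| <o |L|"
        using card[OF L(1)] card_of_image ordLeq_ordLess_trans ordLess_ordLeq_trans by metis
      then obtain x where "x \<in> L" "\<And>y z. \<lbrakk>y \<in> f ` underS L; z \<in> f ` underS L; y \<noteq> z\<rbrakk>
          \<Longrightarrow> \<not> collinear_in \<L> x y z"
        using exists_noncollinear_point[OF pls L(1) inf[OF L(1)] _ L(2)] by metis
      then show ?thesis
        unfolding good_def by blast
    qed (auto simp: good_def)
  qed
  then obtain f where good: "\<And>L. L \<in> \<L> \<Longrightarrow> good f L (f L)"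
    by blast
  define P where "P = f ` \<L>"
  \<comment> \<open>Each point of \<open>P\<close> has a first line on which it is chosen. There it is not a repetition,
    so it satisfies the second alternative of \<open>good\<close>.\<close>
  have "\<exists>L. L \<in> \<L> \<and> f L = x \<and> x \<notin> f ` underS L" if x: "x \<in> P" for x
  proof -
    let ?F = "{L \<in> \<L>. f L = x}"
    obtain L0 where "L0 \<in> ?F"
      using x unfolding P_def by blast
    then have "\<exists>L\<in>?F. \<forall>M. (M, L) \<in> r - Id \<longrightarrow> M \<notin> ?F"
      by (rule WF[unfolded wf_eq_minimal, rule_format])
    then obtain L where L: "L \<in> ?F" and least: "\<forall>M. (M, L) \<in> r - Id \<longrightarrow> M \<notin> ?F"
      by blast
    have "x \<notin> f ` underS L"
    proof
      assume "x \<in> f ` underS L"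
      then obtain M where M: "M \<noteq> L" "(M, L) \<in> r" "f M = x"
        unfolding Order_Relation.underS_def by blast
      then have "M \<in> \<L>"
        using Field by (auto simp: Field_def)
      then show False
        using least M by blast
    qed
    then show ?thesis
      using L by blast
  qed
  then obtain g where g: "\<And>x. x \<in> P \<Longrightarrow> g x \<in> \<L> \<and> f (g x) = x \<and> x \<notin> f ` underS (g x)"
    by metis
  have underS_g: "y \<in> f ` underS (g x)"
    if "x \<in> P" "y \<in> P" "x \<noteq> y" "(g y, g x) \<in> r" for x y
  proof -
    have "f (g x) = x" "f (g y) = y"
      using g that by blast+
    then show ?thesis
      using that unfolding Order_Relation.underS_def by (intro image_eqI[of _ _ "g y"]) auto
  qed
  have last: "\<not> collinear_in \<L> x y z"
    if xyz: "{x, y, z} \<subseteq> P" "distinct [x, y, z]" "(g y, g x) \<in> r" "(g z, g x) \<in> r" for x y z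
  proof -
    have "good f (g x) x" "x \<notin> f ` underS (g x)"
      using g[of x] good[of "g x"] xyz(1) by auto
    moreover have "y \<in> f ` underS (g x)" "z \<in> f ` underS (g x)"
      using underS_g[of x y] underS_g[of x z] xyz by auto
    moreover have "y \<noteq> z"
      using xyz(2) by simp
    ultimately show ?thesis
      unfolding good_def by blast
  qed
  show thesis
  proof (rule that[of P])
    show "L \<inter> P \<noteq> {}" if "L \<in> \<L>" for L
      using good[OF that] that unfolding good_def P_def by blast
  next
    fix x y z
    assume xyz: "{x, y, z} \<subseteq> P" "distinct [x, y, z]"
    have total: "(g a, g b) \<in> r \<or> (g b, g a) \<in> r" if "a \<in> P" "b \<in> P" for a b
      using TOTALS g that Field by auto
    have perm: "collinear_in \<L> x y z = collinear_in \<L> y x z"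
      "collinear_in \<L> x y z = collinear_in \<L> z x y"
      unfolding collinear_in_def by auto
    \<comment> \<open>One of the three points is the last to appear, and it is not collinear with the others.\<close>
    consider "(g y, g x) \<in> r" "(g z, g x) \<in> r" | "(g x, g y) \<in> r" "(g z, g y) \<in> r"
      | "(g x, g z) \<in> r" "(g y, g z) \<in> r"
      using total[of x y] total[of x z] total[of y z] xyz(1) transD[OF TRANS] by auto
    then show "\<not> collinear_in \<L> x y z"
    proof cases
      case 1
      then show ?thesis
        using last[of x y z] xyz by simp
    next
      case 2
      then show ?thesis
        using last[of y x z] perm(1) xyz by auto
    next
      case 3
      then show ?thesis
        using last[of z x y] perm(2) xyz by auto
    qed
  qed
qed

context vector_space
begin

section \<open>Lines of a vector space of countable dimension\<close>

definition line :: "'b \<Rightarrow> 'b \<Rightarrow> 'b set" where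
  "line v d = range (\<lambda>t. v + scale t d)"

definition lines :: "'b set set" where
  "lines = {line v d | v d. d \<noteq> 0}"

lemma lineI: "v + scale t d \<in> line v d"
  unfolding line_def by blast

lemma affine_line_in_lines:
  assumes "affine_line L"
  shows "L \<in> lines"
proof -
  obtain v W where W: "subspace W" "dim W = 1" "L = (+) v ` W"
    using assms unfolding affine_line_def by blast
  obtain D where D: "D \<subseteq> W" "independent D" "W \<subseteq> span D" "card D = 1"
    using basis_exists[of W] W(2) by metis
  then obtain d where d: "D = {d}"
    by (auto simp: card_1_singleton_iff)
  have "W = span {d}"
    using D W(1) span_minimal d by blast
  then have "L = line v d"
    unfolding W(3) line_def span_singleton by auto
  moreover have "d \<noteq> 0"
    using D(2) d dependent_zero by blast
  ultimately show ?thesis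
    unfolding lines_def by blast
qed

lemma line_eq_line_through:
  assumes "x \<in> line v d" "y \<in> line v d" "x \<noteq> y"
  shows "line v d = line x (y - x)"
proof -
  obtain s t where s: "x = v + scale s d" and t: "y = v + scale t d"
    using assms unfolding line_def by blast
  have "t - s \<noteq> 0"
    using s t assms(3) by auto
  have "v + scale u d = x + scale ((u - s) / (t - s)) (y - x)" for u
  proof -
    have "y - x = scale (t - s) d"
      unfolding s t by (simp add: scale_left_diff_distrib)
    then have "scale ((u - s) / (t - s)) (y - x) = scale (u - s) d"
      using \<open>t - s \<noteq> 0\<close> by simp
    then show ?thesis
      unfolding s by (simp add: scale_left_diff_distrib)
  qed
  then have "line v d \<subseteq> line x (y - x)"
    unfolding line_def by blast
  moreover have "x + scale u (y - x) = v + scale (s + u * (t - s)) d" for u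
    unfolding s t by (simp add: scale_left_diff_distrib scale_left_distrib
      scale_right_diff_distrib algebra_simps)
  then have "line x (y - x) \<subseteq> line v d"
    unfolding line_def by blast
  ultimately show ?thesis
    by blast
qed

lemma partial_linear_space_lines: "partial_linear_space lines"
proof -
  have "L = line x (y - x)" if "L \<in> lines" "{x, y} \<subseteq> L" "x \<noteq> y" for L x y
    using that(1,2) line_eq_line_through[OF _ _ that(3)] unfolding lines_def by auto
  then show ?thesis
    unfolding partial_linear_space_def by (metis le_inf_iff)
qed

lemma card_of_line:
  assumes "L \<in> lines"
  shows "|UNIV :: 'a set| \<le>o |L|"
proof -
  obtain v d where "d \<noteq> 0" "L = line v d"
    using assms unfolding lines_def by blast
  then have "inj (\<lambda>t. v + scale t d)" "range (\<lambda>t. v + scale t d) \<subseteq> L"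
    unfolding line_def by (auto simp: inj_on_def)
  then show ?thesis
    using card_of_ordLeq by blast
qed

lemma card_of_span_finite:
  assumes "infinite (UNIV :: 'a set)" "finite S"
  shows "|span S| \<le>o |UNIV :: 'a set|"
  using assms(2)
proof (induction S)
  case empty
  show ?case
    using assms(1) by (intro ordLess_imp_ordLeq finite_ordLess_infinite) (simp_all add: card_of_well_order_on Field_card_of)
next
  case (insert a S)
  have "span (insert a S) \<subseteq> (\<lambda>(k, x). x + scale k a) ` (UNIV \<times> span S)"
  proof
    fix x
    assume "x \<in> span (insert a S)"
    then obtain k where "x - scale k a \<in> span S"
      unfolding span_insert by blast
    then show "x \<in> (\<lambda>(k, x). x + scale k a) ` (UNIV \<times> span S)"
      by (intro image_eqI[of _ _ "(k, x - scale k a)"]) auto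
  qed
  then have "|span (insert a S)| \<le>o |(UNIV :: 'a set) \<times> span S|"
    by (meson card_of_image card_of_mono1 ordLeq_transitive)
  also have "|(UNIV :: 'a set) \<times> span S| \<le>o |(UNIV :: 'a set) \<times> (UNIV :: 'a set)|"
    using insert.IH by (rule card_of_Times_mono2)
  also have "|(UNIV :: 'a set) \<times> (UNIV :: 'a set)| =o |UNIV :: 'a set|"
    using assms(1) by (rule card_of_Times_same_infinite)
  finally show ?case .
qed

lemma card_of_vectors:
  assumes "infinite (UNIV :: 'a set)" "countably_infinite_dimensional"
  shows "|UNIV :: 'b set| \<le>o |UNIV :: 'a set|"
proof -
  obtain B where B: "span B = UNIV" "countable B"
    using assms(2) unfolding countably_infinite_dimensional_def by blast
  let ?I = "{S. finite S \<and> S \<subseteq> B}"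
  have "countable ?I"
    using countable_Collect_finite_subset[OF B(2)] by (simp add: conj_commute)
  then have "|?I| \<le>o |UNIV :: nat set|"
    unfolding countable_def using card_of_ordLeq by blast
  also have "|UNIV :: nat set| \<le>o |UNIV :: 'a set|"
    using assms(1) infinite_iff_card_of_nat by blast
  finally have I: "|?I| \<le>o |UNIV :: 'a set|" .
  have "x \<in> (\<Union>S\<in>?I. span S)" for x
  proof -
    have "x \<in> span B"
      using B(1) by blast
    then obtain S c where S: "finite S" "S \<subseteq> B" "x = (\<Sum>b\<in>S. scale (c b) b)"
      unfolding span_explicit by blast
    then have "x \<in> span S"
      unfolding S(3) by (intro span_sum span_scale span_base)
    then show ?thesis
      using S by blast
  qed
  then have "(UNIV :: 'b set) = (\<Union>S\<in>?I. span S)"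
    by blast
  moreover have "|\<Union>S\<in>?I. span S| \<le>o |UNIV :: 'a set|"
    using assms(1) by (intro card_of_UNION_ordLeq_infinite I ballI card_of_span_finite) auto
  ultimately show ?thesis
    by metis
qed

lemma card_of_lines:
  assumes "infinite (UNIV :: 'a set)" "countably_infinite_dimensional"
  shows "|lines| \<le>o |UNIV :: 'a set|"
proof -
  have "lines \<subseteq> (\<lambda>(v, d). line v d) ` (UNIV \<times> UNIV)"
    unfolding lines_def by auto
  then have "|lines| \<le>o |(UNIV :: 'b set) \<times> (UNIV :: 'b set)|"
    by (meson card_of_image card_of_mono1 ordLeq_transitive)
  also have "|(UNIV :: 'b set) \<times> (UNIV :: 'b set)| \<le>o |(UNIV :: 'a set) \<times> (UNIV :: 'b set)|"
    using card_of_vectors[OF assms] by (rule card_of_Times_mono1)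
  also have "|(UNIV :: 'a set) \<times> (UNIV :: 'b set)| \<le>o |(UNIV :: 'a set) \<times> (UNIV :: 'a set)|"
    using card_of_vectors[OF assms] by (rule card_of_Times_mono2)
  also have "|(UNIV :: 'a set) \<times> (UNIV :: 'a set)| =o |UNIV :: 'a set|"
    using assms(1) by (rule card_of_Times_same_infinite)
  finally show ?thesis .
qed

lemma ex_nonzero_vector:
  assumes "countably_infinite_dimensional"
  obtains b :: 'b where "b \<noteq> 0"
  using assms dependent_zero unfolding countably_infinite_dimensional_def
  by (metis finite.emptyI ex_in_conv)

section \<open>Collinear triples as affine cycles\<close>

text \<open>
  Every proper subsequence of a list of three distinct vectors has this form, which leaves only
  the dependence of the triple itself to check when proving it to be an affine cycle.
\<close>

lemma affinely_independent_distinct_short: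
  assumes "distinct us" "length us \<le> 2"
  shows "\<not> affinely_dependent us"
proof -
  consider "us = []" | x where "us = [x]" | x y where "us = [x, y]"
    using assms(2) by (auto simp: le_Suc_eq numeral_2_eq_2 length_Suc_conv)
  then show ?thesis
  proof cases
    case (3 x y)
    have "c i = 0" if "i < 2" and c: "c 0 + c 1 = 0" "scale (c 0) x + scale (c 1) y = 0"
      for c :: "nat \<Rightarrow> 'a" and i
    proof -
      have "c 1 = - c 0"
        using c(1) by (simp add: eq_neg_iff_add_eq_0 add.commute)
      then have "scale (c 0) (x - y) = 0"
        using c(2) by (simp add: scale_right_diff_distrib)
      then have "c 0 = 0"
        using 3 assms(1) by simp
      then show ?thesis
        using \<open>c 1 = - c 0\<close> \<open>i < 2\<close> by (auto simp: less_2_cases_iff)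
    qed
    then show ?thesis
      using 3 unfolding affinely_dependent_def
      by (auto simp: numeral_2_eq_2)
  qed (auto simp: affinely_dependent_def)
qed

lemma collinear_triple_affine_cycle:
  assumes "b \<noteq> 0" "c \<noteq> 0" "c \<noteq> 1"
  shows "affine_cycle [0, b, scale c b]"
proof -
  have distinct: "distinct [0, b, scale c b]"
    using assms by (auto simp: scale_cancel_right[of 1 b c, simplified])
  \<comment> \<open>From \<open>- c b + c b = 0\<close>, with the coefficient of the vector 0 making the total zero.\<close>
  let ?k = "\<lambda>i::nat. if i = 0 then c - 1 else if i = 1 then - c else 1"
  have "affinely_dependent [0, b, scale c b]"
    unfolding affinely_dependent_def
    by (rule exI[of _ ?k]) (auto simp: numeral_3_eq_3 lessThan_Suc)
  moreover have "\<not> affinely_dependent us" if "strict_subseq us [0, b, scale c b]" for us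
  proof (rule affinely_independent_distinct_short)
    have us: "subseq us [0, b, scale c b]" "us \<noteq> [0, b, scale c b]"
      using that unfolding strict_subseq_def by auto
    then show "distinct us"
      using distinct subseqs_distinctD by (metis set_subseqs_eq mem_Collect_eq)
    have "length us \<le> 3" "length us \<noteq> 3"
      using us list_emb_length[OF us(1)] subseq_same_length[OF us(1)] by auto
    then show "length us \<le> 2"
      by simp
  qed
  ultimately show ?thesis
    unfolding affine_cycle_def by blast
qed

lemma cycle_equiv_refl: "affine_cycle us \<Longrightarrow> (us, us) \<in> cycle_equiv"
proof -
  have "affine_map_on A (\<lambda>x. x)" for A
    unfolding affine_map_on_def using linear_id by force
  then show "affine_cycle us \<Longrightarrow> (us, us) \<in> cycle_equiv"
    unfolding cycle_equiv_def by (auto intro!: exI[of _ "\<lambda>x. x"] simp: bij_betw_def)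
qed

text \<open>
  Equivalence of cycles preserves collinearity, and this is how the relation symbol of the class
  of \<open>[0, b, c b]\<close> detects a collinear triple in an induced substructure.
\<close>

lemma cycle_equiv_collinear_triple:
  assumes "([0, b, scale c b], vs) \<in> cycle_equiv" "distinct vs"
  obtains x y z where "vs = [x, y, z]" "collinear_in lines x y z"
proof -
  obtain w \<rho> where \<rho>: "Vector_Spaces.linear scale scale \<rho>"
    and vs: "vs = map (\<lambda>x. w + \<rho> x) [0, b, scale c b]"
  proof -
    obtain \<tau> where \<tau>: "affine_map_on (affine_subspace hull set [0, b, scale c b]) \<tau>"
      "vs = map \<tau> [0, b, scale c b]"
      using assms(1) unfolding cycle_equiv_def by blast
    then obtain w \<rho> where \<rho>: "Vector_Spaces.linear scale scale \<rho>"
      and eq: "\<And>x. x \<in> affine_subspace hull set [0, b, scale c b] \<Longrightarrow> \<tau> x = w + \<rho> x"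
      unfolding affine_map_on_def by blast
    have "vs = map (\<lambda>x. w + \<rho> x) [0, b, scale c b]"
      unfolding \<tau>(2) by (intro map_cong refl eq hull_inc)
    then show thesis
      using that \<rho> by blast
  qed
  interpret \<rho>: Vector_Spaces.linear scale scale \<rho>
    by (rule \<rho>)
  have eq: "vs = [w, w + \<rho> b, w + scale c (\<rho> b)]"
    unfolding vs by (simp add: \<rho>.zero \<rho>.scale)
  have "\<rho> b \<noteq> 0"
    using assms(2) unfolding eq by auto
  then have "line w (\<rho> b) \<in> lines"
    unfolding lines_def by blast
  moreover have "{w, w + \<rho> b, w + scale c (\<rho> b)} \<subseteq> line w (\<rho> b)"
    using lineI[of w 0 "\<rho> b"] lineI[of w 1 "\<rho> b"] lineI[of w c "\<rho> b"] by simp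
  ultimately show thesis
    using that[OF eq] unfolding collinear_in_def by blast
qed

text \<open>
  The substructure induced on \<open>{0, b, c b}\<close> is not realised in \<open>P\<close>: a copy would carry a list of three
  distinct points of \<open>P\<close> in the class of \<open>[0, b, c b]\<close>, and such points are collinear.
\<close>

lemma age_without_collinear_triples:
  assumes "infinite (UNIV :: 'a set)" and "b \<noteq> (0 :: 'b)"
    and P: "\<And>x y z. \<lbrakk>{x, y, z} \<subseteq> P; distinct [x, y, z]\<rbrakk> \<Longrightarrow> \<not> collinear_in lines x y z"
  shows "age (induced affine_cycle_structure P) \<noteq> age affine_cycle_structure"
proof
  assume eq: "age (induced affine_cycle_structure P) = age affine_cycle_structure"
  obtain c :: 'a where c: "c \<noteq> 0" "c \<noteq> 1"
    using ex_new_if_finite[OF assms(1), of "{0, 1}"] by auto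
  define us where "us = [0, b, scale c b]"
  define S where "S = set us"
  define R where "R = cycle_equiv `` {us}"
  have "affine_cycle us"
    unfolding us_def using assms(2) c by (rule collinear_triple_affine_cycle)
  then have R: "rel affine_cycle_structure R = R" and "us \<in> R"
    unfolding R_def affine_cycle_structure_def
    by (auto simp: quotientI cycle_equiv_refl)
  have "finite S" "S \<noteq> {}"
    unfolding S_def us_def by auto
  obtain f :: "'b \<Rightarrow> nat" where f: "inj_on f S"
    using finite_imp_inj_to_nat_seg[OF \<open>finite S\<close>] by blast
  \<comment> \<open>Ages collect structures on sets of natural numbers, so the triple is moved there by \<open>f\<close>.\<close>
  define B where "B = \<lparr>base = f ` S, rel = (\<lambda>Q. map f ` rel (induced affine_cycle_structure S) Q)\<rparr>"
  have "struct_iso (induced affine_cycle_structure S) B"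
    unfolding struct_iso_def B_def using f
    by (intro exI[of _ f]) (auto simp: induced_def affine_cycle_structure_def bij_betw_def)
  then have "B \<in> age affine_cycle_structure"
    unfolding age_def using \<open>finite S\<close> \<open>S \<noteq> {}\<close> by (auto simp: affine_cycle_structure_def)
  then have "B \<in> age (induced affine_cycle_structure P)"
    using eq by simp
  then obtain T g where g: "\<And>Q. rel B Q = map g ` rel (induced (induced affine_cycle_structure P) T) Q"
    unfolding age_def struct_iso_def by blast
  have "map f us \<in> rel B R"
    using \<open>us \<in> R\<close> R unfolding B_def induced_def S_def by auto
  then obtain vs where vs: "vs \<in> R" "set vs \<subseteq> P" "map f us = map g vs"
    unfolding g induced_def using R by auto
  have "distinct us"
    using assms(2) c unfolding us_def
    by (auto simp: scale_cancel_right[of 1 b c, simplified])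
  then have "distinct (map g vs)"
    using f vs(3) unfolding S_def by (metis distinct_map)
  then have distinct: "distinct vs"
    by (simp add: distinct_map)
  have "([0, b, scale c b], vs) \<in> cycle_equiv"
    using vs(1) unfolding R_def us_def by simp
  then obtain x y z where "vs = [x, y, z]" "collinear_in lines x y z"
    using distinct by (rule cycle_equiv_collinear_triple)
  then show False
    using P[of x y z] vs(2) distinct by simp
qed

lemma affine_embedding_range_contains_line:
  assumes "affine_embedding \<epsilon>" "b \<noteq> (0 :: 'b)"
  obtains L where "L \<in> lines" "L \<subseteq> range \<epsilon>"
proof -
  obtain w \<rho> where \<rho>: "Vector_Spaces.linear scale scale \<rho>" and \<epsilon>: "\<And>x. \<epsilon> x = w + \<rho> x"
    and inj: "inj \<epsilon>"
    using assms(1) unfolding affine_embedding_def affine_map_on_def by blast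
  interpret \<rho>: Vector_Spaces.linear scale scale \<rho>
    by (rule \<rho>)
  have "\<rho> b \<noteq> 0"
    using inj_eq[OF inj, of b 0] assms(2) unfolding \<epsilon> by (auto simp: \<rho>.zero)
  moreover have "w + scale t (\<rho> b) = \<epsilon> (scale t b)" for t
    unfolding \<epsilon> by (simp add: \<rho>.scale)
  then have "line w (\<rho> b) \<subseteq> range \<epsilon>"
    unfolding line_def by auto
  ultimately show thesis
    using that unfolding lines_def by blast
qed

end

section \<open>A partition with no line in either part\<close>

theorem theorem14:
  fixes scale :: "'a::field \<Rightarrow> 'v::ab_group_add \<Rightarrow> 'v"
  assumes "vector_space scale"
    and "infinite (UNIV :: 'a set)"
    and "vector_space.countably_infinite_dimensional scale"
  shows "\<not> vector_space.weakly_indivisible scale \<and>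
    (\<exists>P0 P1. two_partition (UNIV :: 'v set) P0 P1 \<and>
      (\<forall>L. vector_space.affine_line scale L \<longrightarrow> \<not> L \<subseteq> P0 \<and> \<not> L \<subseteq> P1))"
proof -
  interpret vector_space scale
    by (rule assms(1))
  have inf: "infinite L" if "L \<in> lines" for L
    using card_of_line[OF that] assms(2) card_of_ordLeq_infinite by blast
  have card: "|lines| \<le>o |L|" if "L \<in> lines" for L
    using card_of_lines[OF assms(2,3)] card_of_line[OF that] by (rule ordLeq_transitive)
  obtain P where meets: "\<And>L. L \<in> lines \<Longrightarrow> L \<inter> P \<noteq> {}"
    and triples: "\<And>x y z. \<lbrakk>{x, y, z} \<subseteq> P; distinct [x, y, z]\<rbrakk> \<Longrightarrow> \<not> collinear_in lines x y z"
  proof (rule exists_blocking_set_without_collinear_triples[OF partial_linear_space_lines inf card])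
    fix P
    assume "\<And>L. L \<in> lines \<Longrightarrow> L \<inter> P \<noteq> {}"
      and "\<And>x y z. \<lbrakk>{x, y, z} \<subseteq> P; distinct [x, y, z]\<rbrakk> \<Longrightarrow> \<not> collinear_in lines x y z"
    then show thesis
      by (rule that)
  qed
  have not_in_P: "\<not> L \<subseteq> P" if L: "L \<in> lines" for L
  proof
    assume "L \<subseteq> P"
    obtain T where "T \<subseteq> L" "finite T" "card T = 3"
      using infinite_arbitrarily_large[OF inf[OF L]] by metis
    then obtain x y z where "{x, y, z} \<subseteq> L" "distinct [x, y, z]"
      by (auto simp: card_3_iff)
    moreover from this have "collinear_in lines x y z"
      unfolding collinear_in_def using L by blast
    ultimately show False
      using triples[of x y z] \<open>L \<subseteq> P\<close> by blast
  qed
  obtain b :: 'v where b: "b \<noteq> 0"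
    using ex_nonzero_vector[OF assms(3)] .
  then have "line 0 b \<in> lines"
    unfolding lines_def by blast
  then have "P \<noteq> {}" "- P \<noteq> {}"
    using meets not_in_P by blast+
  then have partition: "two_partition UNIV P (- P)"
    unfolding two_partition_def by (auto simp: partition_on_def disjoint_def)
  have "\<not> range \<epsilon> \<subseteq> - P" if emb: "affine_embedding \<epsilon>" for \<epsilon>
  proof -
    obtain L where "L \<in> lines" "L \<subseteq> range \<epsilon>"
      using emb b by (rule affine_embedding_range_contains_line)
    then show ?thesis
      using meets by blast
  qed
  moreover have "age (induced affine_cycle_structure P) \<noteq> age affine_cycle_structure"
    using assms(2) b triples by (rule age_without_collinear_triples)
  ultimately have "\<not> weakly_indivisible"
    unfolding weakly_indivisible_def using partition by blast
  moreover have "\<not> L \<subseteq> P \<and> \<not> L \<subseteq> - P" if "affine_line L" for L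
    using meets not_in_P affine_line_in_lines[OF that] by blast
  ultimately show ?thesis
    using partition by blast
qed

end
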